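(* The set $\mathrm{HI}=\{X\in\mathrm{SB}: X\text{ is hereditarily indecomposable}\}$ is coanalytic.
   Context: $\mathrm{SB}$ is the standard Borel space of closed linear subspaces of $C(\Delta)$ ($\Delta$ the Cantor set) with the Effros–Borel structure. An infinite dimensional Banach space is hereditarily indecomposable if none of its closed subspaces is the direct sum of two infinite dimensional closed subspaces. *)

theory Defs
  imports "HOL-Analysis.Analysis"
begin

text \<open>The Cantor set is modelled as the Cantor space {0,1}^N, i.e. the type nat => bool
  with the product of the discrete topologies (homeomorphic to the middle-thirds set).
  C(Delta) is the real Banach space of (bounded) continuous real functions on it.\<close>

type_synonym cantor = "nat \<Rightarrow> bool"
type_synonym C_Delta = "cantor \<Rightarrow>\<^sub>C real"

definition closed_subspace :: "'a::real_normed_vector set \<Rightarrow> bool" where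
  "closed_subspace X \<longleftrightarrow> subspace X \<and> closed X"

definition SB :: "C_Delta set set" where
  "SB = {X. closed_subspace X}"

definition SB_Effros :: "C_Delta set measure" where
  "SB_Effros = sigma SB {{F \<in> SB. F \<inter> U \<noteq> {}} | U. open U}"

definition infinite_dimensional :: "'a::real_vector set \<Rightarrow> bool" where
  "infinite_dimensional X \<longleftrightarrow> \<not> (\<exists>B. finite B \<and> X \<subseteq> span B)"

definition decomposable :: "'a::real_normed_vector set \<Rightarrow> bool" where
  "decomposable Y \<longleftrightarrow> (\<exists>Z W. closed_subspace Z \<and> closed_subspace W \<and>
      infinite_dimensional Z \<and> infinite_dimensional W \<and>
      Z \<inter> W = {0} \<and> {z + w | z w. z \<in> Z \<and> w \<in> W} = Y)"

definition hereditarily_indecomposable :: "'a::real_normed_vector set \<Rightarrow> bool" where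
  "hereditarily_indecomposable X \<longleftrightarrow> infinite_dimensional X \<and>
     (\<forall>Y. closed_subspace Y \<and> Y \<subseteq> X \<longrightarrow> \<not> decomposable Y)"

definition analytic_in :: "'a measure \<Rightarrow> 'a set \<Rightarrow> bool" where
  "analytic_in M A \<longleftrightarrow> A = {} \<or>
     (\<exists>f. f \<in> measurable (borel :: (nat \<Rightarrow> nat) measure) M \<and> range f = A)"

definition coanalytic_in :: "'a measure \<Rightarrow> 'a set \<Rightarrow> bool" where
  "coanalytic_in M A \<longleftrightarrow> A \<subseteq> space M \<and> analytic_in M (space M - A)"

end

theory Submission
  imports Defs
begin

text \<open>
  A closed subspace \<open>X\<close> of \<open>C(\<Delta>)\<close> fails to be hereditarily indecomposable iff it is finite
  dimensional or contains closed infinite dimensional \<open>Z\<close> and \<open>W\<close> whose sum is direct and closed.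
  By the open mapping theorem the latter amounts to an inequality \<open>norm z \<le> C * norm (z + w)\<close>,
  and infinite dimensionality is witnessed by a sequence each of whose terms has distance at
  least 1 from the span of its predecessors. Hence \<open>X\<close> is not hereditarily indecomposable iff it
  is the closed span of a sequence that either is eventually zero or contains such witnesses for
  \<open>Z\<close> and \<open>W\<close> as subsequences, with the inequality holding on finite linear combinations. These
  conditions define an \<open>F\<^sub>\<sigma>\<close> set of sequences. Sequences in \<open>C(\<Delta>)\<close> are a continuous image of
  the Baire space, and the closed span depends on the sequence in a Borel way, so the complement of
  HI is analytic.
\<close>

section \<open>Completeness and separability of the space of continuous functions\<close>

text \<open>The library has this instance only for metric domains, and \<^typ>\<open>bool\<close>, hence
  \<^typ>\<open>cantor\<close>, is not of class \<^class>\<open>metric_space\<close>.\<close>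

instance bcontfun :: (topological_space, complete_space) complete_space
proof
  fix f :: "nat \<Rightarrow> ('a, 'b) bcontfun"
  assume "Cauchy f"
  then have "uniformly_Cauchy_on UNIV (\<lambda>n. apply_bcontfun (f n))"
    unfolding uniformly_Cauchy_on_def Cauchy_def by (meson dist_fun_lt_imp_dist_val_lt)
  then obtain g where "uniform_limit UNIV (\<lambda>n. apply_bcontfun (f n)) g sequentially"
    using Cauchy_uniformly_convergent unfolding uniformly_convergent_on_def by blast
  then show "convergent f"
    by (metis uniform_limit_bcontfunE sequentially_bot convergentI)
qed

instance bcontfun :: (topological_space, banach) banach ..

section \<open>Compactness and cylinder sets of the Cantor space\<close>

lemma compact_UNIV_cantor: "compact (UNIV :: (nat \<Rightarrow> bool) set)"
proof -
  have "compact_space (product_topology (\<lambda>_::nat. euclidean :: bool topology) UNIV)"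
    by (subst compact_space_product_topology) (auto simp: compact_space_def finite_imp_compact)
  then show ?thesis
    by (simp add: euclidean_product_topology compact_space_def)
qed

text \<open>Over a discrete type these cylinders form a neighbourhood base at \<open>x\<close>; they
  stand in for balls in the uniform continuity argument.\<close>

definition agree :: "nat \<Rightarrow> (nat \<Rightarrow> 'a) \<Rightarrow> (nat \<Rightarrow> 'a) set" where
  "agree n x = {y. \<forall>i<n. y i = x i}"

lemma open_agree: "open (agree n (x :: nat \<Rightarrow> 'a::discrete_topology))"
proof -
  have "agree n x = (\<Inter>i\<in>{..<n}. (\<lambda>y. y i) -` {x i})"
    by (auto simp: agree_def)
  moreover have "open ((\<lambda>y::nat \<Rightarrow> 'a. y i) -` {x i})" for i
    by (intro open_vimage open_discrete continuous_on_product_coordinates)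
  ultimately show ?thesis by auto
qed

lemma open_contains_agree:
  fixes U :: "(nat \<Rightarrow> 'a::discrete_topology) set"
  assumes "open U" "x \<in> U"
  obtains n where "agree n x \<subseteq> U"
proof -
  have "openin (product_topology (\<lambda>_::nat. euclidean :: 'a topology) UNIV) U"
    using assms(1) by (simp add: euclidean_product_topology)
  from product_topology_open_contains_basis[OF this assms(2)]
  obtain X where "x \<in> (\<Pi>\<^sub>E i\<in>UNIV. X i) \<and> (\<forall>i. openin euclidean (X i)) \<and>
      finite {i. X i \<noteq> topspace euclidean} \<and> (\<Pi>\<^sub>E i\<in>UNIV. X i) \<subseteq> U" ..
  then have X: "x \<in> (\<Pi>\<^sub>E i\<in>UNIV. X i)" "finite {i. X i \<noteq> UNIV}" "(\<Pi>\<^sub>E i\<in>UNIV. X i) \<subseteq> U"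
    by simp_all
  from X(2) obtain n where "{i. X i \<noteq> UNIV} \<subseteq> {..<n}"
    unfolding finite_nat_iff_bounded ..
  then have n: "i < n" if "X i \<noteq> UNIV" for i
    using that by blast
  have "y i \<in> X i" if "y \<in> agree n x" for y i
    using that X(1) n[of i] by (cases "i < n") (auto simp: agree_def PiE_iff)
  then have "agree n x \<subseteq> U" using X(3) by (auto simp: PiE_iff)
  then show thesis by (rule that)
qed

text \<open>Heine-Cantor with cylinders in place of balls: finitely many cylinders on which
  \<open>f\<close> varies little cover the space, and the largest of their lengths serves
  everywhere.\<close>

lemma uniformly_continuous_cantor:
  fixes f :: "(nat \<Rightarrow> bool) \<Rightarrow> 'b::metric_space"
  assumes "continuous_on UNIV f" "e > 0"
  obtains n where "\<And>x y. y \<in> agree n x \<Longrightarrow> dist (f x) (f y) < e"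
proof -
  have "\<exists>n. \<forall>y\<in>agree n x. dist (f x) (f y) < e/2" for x
  proof -
    have "open (f -` ball (f x) (e/2))"
      using assms by (intro open_vimage) auto
    then obtain n where "agree n x \<subseteq> f -` ball (f x) (e/2)"
      using open_contains_agree[of _ x] \<open>e > 0\<close> by (metis centre_in_ball half_gt_zero vimageI)
    then show ?thesis by (intro exI[of _ n]) auto
  qed
  then obtain n where n: "\<And>x y. y \<in> agree (n x) x \<Longrightarrow> dist (f x) (f y) < e/2" by metis
  obtain D where D: "finite D" "UNIV \<subseteq> (\<Union>x\<in>D. agree (n x) x)"
  proof (rule compactE_image[OF compact_UNIV_cantor, of UNIV "\<lambda>x. agree (n x) x"])
    show "open (agree (n x) x)" for x by (rule open_agree)
    have "x \<in> agree (n x) x" for x by (simp add: agree_def)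
    then show "UNIV \<subseteq> (\<Union>x. agree (n x) x)" by blast
  qed
  define N where "N = Max (insert 0 (n ` D))"
  have N: "n x \<le> N" if "x \<in> D" for x using D that by (auto simp: N_def)
  have "dist (f x) (f y) < e" if "y \<in> agree N x" for x y
  proof -
    obtain p where p: "p \<in> D" "x \<in> agree (n p) p" using D by blast
    have "y \<in> agree (n p) p" using that p N[OF p(1)] by (auto simp: agree_def)
    then show ?thesis using n p(2) dist_triangle_half_r by blast
  qed
  then show thesis by (rule that)
qed

text \<open>The table \<open>q\<close> assigns rational values to words of length \<open>n\<close>,
  words not listed getting 0. Such tables are countable data, so these functions can be enumerated
  by \<open>from_nat\<close>.\<close>

definition step_fun :: "nat \<Rightarrow> (bool list \<times> rat) list \<Rightarrow> C_Delta" where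
  "step_fun n q = Bcontfun (\<lambda>x. case map_of q (map x [0..<n]) of None \<Rightarrow> 0 | Some r \<Rightarrow> of_rat r)"

text \<open>The formula depends on \<open>n\<close> coordinates only, hence is continuous, and takes
  finitely many values, hence is bounded; so \<open>Bcontfun\<close> can be inverted on it.\<close>

lemma step_fun_apply:
  "step_fun n q x = (case map_of q (map x [0..<n]) of None \<Rightarrow> 0 | Some r \<Rightarrow> of_rat r)"
proof -
  let ?g = "\<lambda>x. case map_of q (map x [0..<n]) of None \<Rightarrow> 0 | Some r \<Rightarrow> real_of_rat r"
  have "continuous_on UNIV ?g"
    unfolding continuous_on_open_invariant
  proof (intro allI impI)
    fix B :: "real set"
    have "map y [0..<n] = map x [0..<n]" if "y \<in> agree n x" for x y :: cantor
      using that by (auto simp: agree_def)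
    then have *: "agree n x \<subseteq> ?g -` B" if "?g x \<in> B" for x
      using that by (auto simp del: map_eq_conv)
    have "x \<in> agree n x" for x :: cantor by (simp add: agree_def)
    then have "?g -` B = (\<Union>x\<in>?g -` B. agree n x)" using * by blast
    also have "open \<dots>" using open_agree by blast
    finally show "\<exists>A. open A \<and> A \<inter> UNIV = ?g -` B \<inter> UNIV" by auto
  qed
  moreover have "range ?g \<subseteq> insert 0 (of_rat ` snd ` set q)"
    by (force split: option.split dest: map_of_SomeD)
  then have "bounded (range ?g)"
    by (rule bounded_subset[rotated]) auto
  ultimately have "?g \<in> bcontfun" by (simp add: bcontfun_def)
  then show ?thesis unfolding step_fun_def by (simp add: Bcontfun_inverse)
qed

lemma separable_C_Delta: "\<exists>d :: nat \<Rightarrow> C_Delta. closure (range d) = UNIV"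
proof (intro exI)
  let ?d = "(\<lambda>k. case_prod step_fun (from_nat k))"
  have "\<exists>y\<in>range ?d. dist y f < e" if e: "e > 0" for f :: C_Delta and e
  proof -
    obtain n where n: "\<And>x y. y \<in> agree n x \<Longrightarrow> dist (f x) (f y) < e/4"
      using uniformly_continuous_cantor[of f "e/4"] e by auto
    \<comment> \<open>Prolonging the word \<open>l\<close> by \<open>False\<close> picks a sample
      point in its cylinder, where the value of \<open>f\<close> is rounded to a rational.\<close>
    define ext where "ext l = (\<lambda>i. i < length l \<and> l ! i)" for l :: "bool list"
    have "\<exists>r. dist (of_rat r) (f (ext l)) < e/4" for l
    proof -
      obtain r where "f (ext l) - e/4 < of_rat r" "of_rat r < f (ext l)"
        using of_rat_dense[of "f (ext l) - e/4" "f (ext l)"] e by auto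
      then show ?thesis by (intro exI[of _ r]) (auto simp: dist_real_def)
    qed
    then obtain r where r: "\<And>l. dist (of_rat (r l)) (f (ext l)) < e/4" by metis
    define q where "q = map (\<lambda>l. (l, r l)) (List.n_lists n [True, False])"
    \<comment> \<open>One \<open>e/4\<close> pays for the rounding, the other for moving from the
      sample point to \<open>x\<close>. The weak bound \<open>e/2\<close> survives the supremum over
      \<open>x\<close> and is still below \<open>e\<close>.\<close>
    have "dist (step_fun n q x) (f x) \<le> e/2" for x
    proof -
      have "map x [0..<n] \<in> set (List.n_lists n [True, False])"
        by (auto simp: set_n_lists)
      then have "step_fun n q x = of_rat (r (map x [0..<n]))"
        by (simp add: step_fun_apply q_def map_of_map_restrict)
      moreover have "x \<in> agree n (ext (map x [0..<n]))"
        by (auto simp: agree_def ext_def)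
      ultimately show ?thesis
        using r[of "map x [0..<n]"] n[of x "ext (map x [0..<n])"]
          dist_triangle[of "of_rat (r (map x [0..<n]))" "f x" "f (ext (map x [0..<n]))"] by simp
    qed
    then have "dist (step_fun n q) f \<le> e/2" by (rule dist_bound)
    then have "dist (?d (to_nat (n, q))) f < e" using e by simp
    then show ?thesis by blast
  qed
  then show "closure (range ?d) = UNIV" by (auto simp: closure_approachable)
qed

section \<open>Infinite dimensional subspaces and direct sums\<close>

text \<open>Homogeneity of the distance to \<open>V\<close>: division by \<open>k\<close> leads back
  to the distance from \<open>a\<close> to \<open>- v / k\<close>.\<close>

lemma norm_ge_dist_subspace:
  fixes a v :: "'a::real_normed_vector"
  assumes "subspace V" "v \<in> V" "\<And>u. u \<in> V \<Longrightarrow> d \<le> norm (a - u)"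
  shows "\<bar>k\<bar> * d \<le> norm (k *\<^sub>R a + v)"
proof (cases "k = 0")
  case False
  have "- (v /\<^sub>R k) \<in> V"
    using assms(1,2) by (simp add: subspace_neg subspace_scale)
  from assms(3)[OF this] have "\<bar>k\<bar> * d \<le> \<bar>k\<bar> * norm (a - - (v /\<^sub>R k))"
    by (simp add: mult_left_mono)
  also have "\<dots> = norm (k *\<^sub>R (a - - (v /\<^sub>R k)))" by simp
  also have "k *\<^sub>R (a - - (v /\<^sub>R k)) = k *\<^sub>R a + v"
    using False by (simp add: scaleR_add_right)
  finally show ?thesis .
qed simp

lemma closed_subspace_pos_dist:
  fixes a :: "'a::real_normed_vector"
  assumes "subspace V" "closed V" "a \<notin> V"
  obtains d where "d > 0" "\<And>u. u \<in> V \<Longrightarrow> d \<le> norm (a - u)"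
proof -
  have "open (- V)" "a \<in> - V" using assms by auto
  then obtain d where "d > 0" "ball a d \<subseteq> - V" by (meson openE)
  then have "d \<le> norm (a - u)" if "u \<in> V" for u
    using that by (auto simp: subset_iff dist_norm not_less[symmetric])
  with \<open>d > 0\<close> show thesis by (rule that)
qed

text \<open>A vector outside the closed span of \<open>S\<close> has positive distance
  \<open>d\<close> from it, so its coefficient is controlled by the norm. Along a convergent
  sequence the coefficients are therefore Cauchy, and what remains converges within
  \<open>span S\<close>.\<close>

lemma closed_span_insert:
  fixes a :: "'a::real_normed_vector"
  assumes cl: "closed (span S)"
  shows "closed (span (insert a S))"
proof (cases "a \<in> span S")
  case True
  then show ?thesis using cl by (simp add: span_redundant)
next
  case False
  obtain d where d: "d > 0" "\<And>u. u \<in> span S \<Longrightarrow> d \<le> norm (a - u)"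
    using closed_subspace_pos_dist[OF subspace_span cl False] by blast
  show ?thesis
    unfolding closed_sequential_limits
  proof safe
    fix x l assume x: "\<forall>n. x n \<in> span (insert a S)" and lim: "x \<longlonglongrightarrow> l"
    then obtain k where k: "\<And>n. x n - k n *\<^sub>R a \<in> span S"
      unfolding span_insert mem_Collect_eq by metis
    have kd: "d * \<bar>k m - k n\<bar> \<le> norm (x m - x n)" for m n
    proof -
      have "(x m - k m *\<^sub>R a) - (x n - k n *\<^sub>R a) \<in> span S"
        using k by (simp add: span_diff)
      from norm_ge_dist_subspace[OF subspace_span this d(2), of "k m - k n"]
      show ?thesis by (simp add: algebra_simps)
    qed
    have "Cauchy k"
    proof (rule metric_CauchyI)
      fix e :: real assume "e > 0"
      then obtain M where M: "\<And>m n. m \<ge> M \<Longrightarrow> n \<ge> M \<Longrightarrow> dist (x m) (x n) < d * e"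
        using metric_CauchyD[OF LIMSEQ_imp_Cauchy[OF lim], of "d * e"] d(1) by auto
      have "dist (k m) (k n) < e" if "m \<ge> M" "n \<ge> M" for m n
      proof -
        have "d * \<bar>k m - k n\<bar> < d * e"
          using kd[of m n] M[OF that] by (simp add: dist_norm)
        then show ?thesis using d(1) by (simp add: dist_real_def)
      qed
      then show "\<exists>M. \<forall>m\<ge>M. \<forall>n\<ge>M. dist (k m) (k n) < e" by blast
    qed
    then obtain c where "k \<longlonglongrightarrow> c" 
      using Cauchy_convergent unfolding convergent_def by blast
    then have "(\<lambda>n. x n - k n *\<^sub>R a) \<longlonglongrightarrow> l - c *\<^sub>R a"
      using lim by (intro tendsto_intros)
    then have "l - c *\<^sub>R a \<in> span S"
      by (rule closed_sequentially[OF cl k])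
    then show "l \<in> span (insert a S)" unfolding span_insert by blast
  qed
qed

lemma closed_span_finite:
  fixes B :: "'a::real_normed_vector set"
  assumes "finite B"
  shows "closed (span B)"
  using assms
proof (induction B)
  case empty
  then show ?case by simp
next
  case (insert a B)
  then show ?case by (intro closed_span_insert)
qed

text \<open>A quantitative form of linear independence: a weak inequality with a fixed constant
  survives limits, so it defines a closed set of sequences, which plain independence would not
  give.\<close>

definition separated :: "(nat \<Rightarrow> 'a::real_normed_vector) \<Rightarrow> bool" where
  "separated z \<longleftrightarrow> (\<forall>k. \<forall>v\<in>span (z ` {..<k}). 1 \<le> norm (z k - v))"

text \<open>Greedy choice: the span of the earlier terms is closed and does not contain
  \<open>Z\<close>, so some \<open>a\<close> in \<open>Z\<close> has distance at least
  \<open>d > 0\<close> from it, and \<open>a /\<^sub>R d\<close> is the next term.\<close>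

lemma infinite_dimensional_separated:
  fixes Z :: "'a::real_normed_vector set"
  assumes "subspace Z" "infinite_dimensional Z"
  obtains z where "separated z" "range z \<subseteq> Z"
proof -
  have "\<exists>z. \<forall>k::nat. z k \<in> Z \<and> (\<forall>v\<in>span (z ` {..<k}). 1 \<le> norm (z k - v))"
  proof (rule dependent_wellorder_choice)
    fix k :: nat and z :: "nat \<Rightarrow> 'a"
    have "\<not> Z \<subseteq> span (z ` {..<k})"
      using assms(2) by (auto simp: infinite_dimensional_def)
    then obtain a where a: "a \<in> Z" "a \<notin> span (z ` {..<k})" by blast
    obtain d where d: "d > 0" "\<And>u. u \<in> span (z ` {..<k}) \<Longrightarrow> d \<le> norm (a - u)"
      using closed_subspace_pos_dist[OF subspace_span closed_span_finite a(2)] by auto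
    have "1 \<le> norm (a /\<^sub>R d - v)" if "v \<in> span (z ` {..<k})" for v
      using norm_ge_dist_subspace[OF subspace_span span_neg[OF that] d(2), of "inverse d"] d(1)
      by (simp add: span_neg)
    then show "\<exists>r. r \<in> Z \<and> (\<forall>v\<in>span (z ` {..<k}). 1 \<le> norm (r - v))"
      using a(1) assms(1) by (intro exI[of _ "a /\<^sub>R d"]) (simp add: subspace_scale)
  next
    fix r and f g :: "nat \<Rightarrow> 'a" and k :: nat
    assume "\<And>y. y < k \<Longrightarrow> f y = g y"
    then have "f ` {..<k} = g ` {..<k}" by auto
    then show "(r \<in> Z \<and> (\<forall>v\<in>span (f ` {..<k}). 1 \<le> norm (r - v))) =
        (r \<in> Z \<and> (\<forall>v\<in>span (g ` {..<k}). 1 \<le> norm (r - v)))" by simp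
  qed
  then show thesis using that unfolding separated_def by blast
qed

lemma separated_infinite_dimensional:
  fixes z :: "nat \<Rightarrow> 'a::real_normed_vector"
  assumes "separated z" "range z \<subseteq> Z"
  shows "infinite_dimensional Z"
  unfolding infinite_dimensional_def
proof
  assume "\<exists>B. finite B \<and> Z \<subseteq> span B"
  then obtain B where B: "finite B" "Z \<subseteq> span B" by blast
  have new: "z k \<notin> span (z ` {..<k})" for k
    using assms(1) unfolding separated_def by (metis diff_self norm_zero not_one_le_zero)
  have "independent (z ` {..<k}) \<and> card (z ` {..<k}) = k" for k
  proof (induction k)
    case (Suc k)
    have "z k \<notin> z ` {..<k}" using new[of k] by (metis span_base)
    then show ?case
      using Suc new[of k] by (simp add: lessThan_Suc independent_insert)
  qed (simp add: independent_empty)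
  moreover have "z ` {..<k} \<subseteq> span B" for k using assms(2) B(2) by blast
  ultimately have "k \<le> card B" for k
    using independent_span_bound[OF B(1)] by metis
  then show False using not_less_eq_eq by blast
qed

section \<open>Closed direct sums and bounded projections\<close>

lemma closed_sum_if_bounded_projection:
  fixes Z W :: "'a::banach set"
  assumes "closed_subspace Z" "closed_subspace W"
    and C: "\<And>z w. z \<in> Z \<Longrightarrow> w \<in> W \<Longrightarrow> norm z \<le> C * norm (z + w)"
  shows "closed {z + w | z w. z \<in> Z \<and> w \<in> W}"
  unfolding closed_sequential_limits
proof (intro allI impI, elim conjE)
  fix y l assume y: "\<forall>n. y n \<in> {z + w | z w. z \<in> Z \<and> w \<in> W}" and lim: "y \<longlonglongrightarrow> l"
  have sub: "subspace Z" "subspace W" "closed Z" "closed W"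
    using assms(1,2) by (auto simp: closed_subspace_def)
  have "\<exists>z. z \<in> Z \<and> y n - z \<in> W" for n
  proof -
    obtain z w where "y n = z + w" "z \<in> Z" "w \<in> W" using y by blast
    then show ?thesis by (intro exI[of _ z]) simp
  qed
  then obtain z where z: "\<And>n. z n \<in> Z" "\<And>n. y n - z n \<in> W" by metis
  \<comment> \<open>The bound is applied to differences, so the \<open>Z\<close>-parts of a
    convergent sequence of sums are Cauchy; their limit, and that of the remainders, stay in the
    closed sets \<open>Z\<close> and \<open>W\<close>.\<close>
  have zy: "norm (z m - z n) \<le> C * norm (y m - y n)" for m n
    using C[of "z m - z n" "(y m - z m) - (y n - z n)"] z sub by (simp add: subspace_diff)
  have "Cauchy z"
  proof (rule metric_CauchyI)
    fix e :: real assume "e > 0"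
    \<comment> \<open>\<open>C\<close> may fail to be positive, and the next lines divide by the
      constant.\<close>
    define D where "D = max C 1"
    have D: "D > 0" by (simp add: D_def)
    obtain M where M: "\<And>m n. m \<ge> M \<Longrightarrow> n \<ge> M \<Longrightarrow> dist (y m) (y n) < e / D"
      using metric_CauchyD[OF LIMSEQ_imp_Cauchy[OF lim], of "e / D"] \<open>e > 0\<close> D by auto
    have "dist (z m) (z n) < e" if "m \<ge> M" "n \<ge> M" for m n
    proof -
      have "norm (z m - z n) \<le> D * norm (y m - y n)"
        using zy[of m n] mult_right_mono[of C D "norm (y m - y n)"] by (simp add: D_def)
      also have "\<dots> < D * (e / D)"
        using M[OF that] D by (intro mult_strict_left_mono) (auto simp: dist_norm)
      finally show ?thesis using D by (simp add: dist_norm)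
    qed
    then show "\<exists>M. \<forall>m\<ge>M. \<forall>n\<ge>M. dist (z m) (z n) < e" by blast
  qed
  then obtain a where a: "z \<longlonglongrightarrow> a" 
      using Cauchy_convergent unfolding convergent_def by blast
  have lim': "(\<lambda>n. y n - z n) \<longlonglongrightarrow> l - a" using lim a by (intro tendsto_intros)
  have "a \<in> Z" "l - a \<in> W"
    by (rule closed_sequentially[OF sub(3) z(1) a], rule closed_sequentially[OF sub(4) z(2) lim'])
  then have "l = a + (l - a) \<and> a \<in> Z \<and> l - a \<in> W" by simp
  then show "l \<in> {z + w | z w. z \<in> Z \<and> w \<in> W}" by blast
qed

text \<open>The Baire category half of the open mapping theorem, for the map \<open>(z, w) \<mapsto> z + w\<close>; the bound
  concerns the component in \<open>Z\<close> only, and exactness is recovered by iterating on the error.\<close>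

lemma direct_sum_almost_bounded:
  fixes Z W :: "'a::banach set"
  assumes "closed_subspace Z" "closed_subspace W"
    and Y: "Y = {z + w | z w. z \<in> Z \<and> w \<in> W}" "closed Y"
  obtains K :: real where "K \<ge> 0"
    "\<And>y. y \<in> Y \<Longrightarrow> \<exists>z\<in>Z. \<exists>w\<in>W. norm z \<le> K * norm y \<and> norm (y - (z + w)) \<le> norm y / 2"
proof -
  have sub: "subspace Z" "subspace W" using assms(1,2) by (auto simp: closed_subspace_def)
  have subY: "subspace Y" unfolding Y(1) by (rule subspace_sums[OF sub])
  \<comment> \<open>These sets exhaust \<open>Y\<close>, which is closed and hence complete, so by
    Baire one of their closures has interior relative to \<open>Y\<close>.\<close>
  define A where "A n = {z + w | z w. z \<in> Z \<and> w \<in> W \<and> norm z \<le> real n}" for n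
  have AY: "closure (A n) \<subseteq> Y" for n
    using Y by (intro closure_minimal) (auto simp: A_def)
  have YA: "Y \<subseteq> (\<Union>n. closure (A n))"
  proof
    fix y assume "y \<in> Y"
    then obtain z w where zw: "y = z + w" "z \<in> Z" "w \<in> W" using Y(1) by blast
    obtain n where "norm z \<le> real n" using real_arch_simple by blast
    then have "y \<in> A n" using zw by (auto simp: A_def)
    then show "y \<in> (\<Union>n. closure (A n))" using closure_subset by blast
  qed
  obtain n where n: "top_of_set Y interior_of closure (A n) \<noteq> {}"
  proof (rule ccontr)
    assume "\<not> thesis"
    then have "top_of_set Y interior_of closure (A n) = {}" for n using that by blast
    moreover have "completely_metrizable_space (top_of_set Y)"
      using Y(2) by (intro completely_metrizable_space_closedin[OF completely_metrizable_space_euclidean]) simp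
    moreover have "closedin (top_of_set Y) (closure (A n))" for n
      using AY by (simp add: closed_subset)
    ultimately have "top_of_set Y interior_of (\<Union>(range (\<lambda>n. closure (A n)))) = {}"
      by (intro Baire_category_alt) auto
    moreover have "\<Union>(range (\<lambda>n. closure (A n))) = topspace (top_of_set Y)"
      using AY YA by auto
    ultimately have "Y = {}" using interior_of_topspace[of "top_of_set Y"] by simp
    then show False using subspace_0[OF subY] by blast
  qed
  then obtain y0 U where U: "openin (top_of_set Y) U" "U \<subseteq> closure (A n)" "y0 \<in> U"
    by (auto simp: interior_of_def)
  then obtain r where r: "r > 0" "ball y0 r \<inter> Y \<subseteq> U" and y0: "y0 \<in> Y"
    unfolding openin_contains_ball by blast
  \<comment> \<open>Subtracting an approximation of the centre \<open>y0\<close> from one of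
    \<open>y0 + y\<close> moves the ball to the origin. This doubles the bound \<open>n\<close> and
    adds two errors of \<open>r/8\<close>.\<close>
  have approx: "\<exists>z\<in>Z. \<exists>w\<in>W. norm z \<le> 2 * real n \<and> norm (y - (z + w)) < r/4"
    if "y \<in> Y" "norm y < r" for y
  proof -
    have "y0 + y \<in> ball y0 r \<inter> Y" using that y0 subY by (simp add: subspace_add dist_norm)
    then have "y0 + y \<in> closure (A n)" "y0 \<in> closure (A n)" using r(2) U by auto
    then obtain a b where a: "a \<in> A n" "dist a (y0 + y) < r/8" and b: "b \<in> A n" "dist b y0 < r/8"
      using r(1) unfolding closure_approachable by (metis divide_pos_pos zero_less_numeral)
    from a(1) obtain z w where zw: "a = z + w" "z \<in> Z" "w \<in> W" "norm z \<le> real n"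
      by (auto simp: A_def)
    from b(1) obtain z' w' where zw': "b = z' + w'" "z' \<in> Z" "w' \<in> W" "norm z' \<le> real n"
      by (auto simp: A_def)
    have "y - ((z - z') + (w - w')) = (b - y0) - (a - (y0 + y))"
      by (simp add: zw(1) zw'(1))
    then have "norm (y - ((z - z') + (w - w'))) \<le> norm (b - y0) + norm (a - (y0 + y))"
      by (metis norm_triangle_ineq4)
    then have "norm (y - ((z - z') + (w - w'))) < r/4"
      using a(2) b(2) by (simp add: dist_norm)
    moreover have "norm (z - z') \<le> 2 * real n"
      using norm_triangle_ineq4[of z z'] zw(4) zw'(4) by simp
    ultimately show ?thesis
      using zw(2,3) zw'(2,3) sub by (meson subspace_diff)
  qed
  show thesis
  proof (rule that)
    show "0 \<le> 4 * real n / r" using r(1) by simp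
    fix y assume y: "y \<in> Y"
    show "\<exists>z\<in>Z. \<exists>w\<in>W. norm z \<le> 4 * real n / r * norm y \<and> norm (y - (z + w)) \<le> norm y / 2"
    proof (cases "y = 0")
      case True
      then show ?thesis using sub subspace_0 by (intro bexI[of _ 0]) auto
    next
      case False
      \<comment> \<open>This factor brings \<open>y\<close> to norm \<open>r/2\<close>, inside the
        ball. Scaling back turns the error \<open>r/4\<close> into \<open>norm y / 2\<close> and the
        bound \<open>2 * n\<close> into \<open>4 * n / r * norm y\<close>.\<close>
      define t where "t = 2 * norm y / r"
      have t: "t > 0" using False r(1) by (simp add: t_def)
      have "norm (y /\<^sub>R t) = r / 2" using False r(1) t by (simp add: t_def)
      then have "\<exists>z\<in>Z. \<exists>w\<in>W. norm z \<le> 2 * real n \<and> norm (y /\<^sub>R t - (z + w)) < r/4"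
        using y subY r(1) by (intro approx) (auto simp: subspace_scale)
      then obtain z w where zw: "z \<in> Z" "w \<in> W" "norm z \<le> 2 * real n"
        "norm (y /\<^sub>R t - (z + w)) < r/4" by blast
      have "y - (t *\<^sub>R z + t *\<^sub>R w) = t *\<^sub>R (y /\<^sub>R t - (z + w))"
        using t by (simp add: algebra_simps)
      then have "norm (y - (t *\<^sub>R z + t *\<^sub>R w)) = t * norm (y /\<^sub>R t - (z + w))"
        using t by simp
      also have "\<dots> \<le> t * (r/4)" using zw(4) t by (intro mult_left_mono) auto
      also have "\<dots> = norm y / 2" using r(1) by (simp add: t_def)
      finally have 1: "norm (y - (t *\<^sub>R z + t *\<^sub>R w)) \<le> norm y / 2" .
      have "norm (t *\<^sub>R z) \<le> t * (2 * real n)" using zw(3) t by (simp add: mult_left_mono)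
      also have "\<dots> = 4 * real n / r * norm y" by (simp add: t_def)
      finally show ?thesis using 1 zw(1,2) sub by (meson subspace_scale)
    qed
  qed
qed

text \<open>Successive approximation: the error halves in each round, so the \<open>Z\<close>-parts
  form an absolutely convergent series whose sum \<open>a\<close> has norm at most
  \<open>2 * K * norm (z + w)\<close>. The rest of \<open>z + w\<close> lies in \<open>W\<close>,
  and directness forces \<open>a = z\<close>.\<close>

lemma direct_sum_bounded_projection:
  fixes Z W :: "'a::banach set"
  assumes Z: "closed_subspace Z" and W: "closed_subspace W" and ZW: "Z \<inter> W = {0}"
    and cl: "closed {z + w | z w. z \<in> Z \<and> w \<in> W}"
  obtains C where "\<And>z w. z \<in> Z \<Longrightarrow> w \<in> W \<Longrightarrow> norm z \<le> C * norm (z + w)"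
proof -
  define Y where "Y = {z + w | z w. z \<in> Z \<and> w \<in> W}"
  have sub: "subspace Z" "subspace W" "closed Z" "closed W"
    using Z W by (auto simp: closed_subspace_def)
  have subY: "subspace Y" unfolding Y_def by (rule subspace_sums[OF sub(1,2)])
  obtain K where K: "K \<ge> 0"
    "\<And>y. y \<in> Y \<Longrightarrow> \<exists>z\<in>Z. \<exists>w\<in>W. norm z \<le> K * norm y \<and> norm (y - (z + w)) \<le> norm y / 2"
    using direct_sum_almost_bounded[OF Z W Y_def] cl unfolding Y_def[symmetric] by blast
  then obtain p q where pq: "\<And>y. y \<in> Y \<Longrightarrow> p y \<in> Z" "\<And>y. y \<in> Y \<Longrightarrow> q y \<in> W"
    "\<And>y. y \<in> Y \<Longrightarrow> norm (p y) \<le> K * norm y"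
    "\<And>y. y \<in> Y \<Longrightarrow> norm (y - (p y + q y)) \<le> norm y / 2"
    by metis
  have "norm z \<le> 2 * K * norm (z + w)" if zw: "z \<in> Z" "w \<in> W" for z w
  proof -
    define y where "y = rec_nat (z + w) (\<lambda>_ u. u - (p u + q u))"
    have y0: "y 0 = z + w" and yS: "y (Suc n) = y n - (p (y n) + q (y n))" for n
      by (simp_all add: y_def)
    have yY: "y n \<in> Y" for n
    proof (induction n)
      case 0
      then show ?case using zw by (auto simp: y0 Y_def)
    next
      case (Suc n)
      have "p (y n) + q (y n) \<in> Y" using pq(1,2)[OF Suc] by (auto simp: Y_def)
      then show ?case using Suc subY by (simp add: yS subspace_diff)
    qed
    have yn: "norm (y n) \<le> norm (z + w) * (1/2)^n" for n
    proof (induction n)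
      case (Suc n)
      then show ?case using pq(4)[OF yY[of n]] by (simp add: yS)
    qed (simp add: y0)
    have pn: "norm (p (y n)) \<le> K * norm (z + w) * (1/2)^n" for n
      using pq(3)[OF yY[of n]] mult_left_mono[OF yn[of n] K(1)] by (simp add: mult.assoc)
    have geo: "(\<lambda>n. K * norm (z + w) * (1/2)^n) sums (K * norm (z + w) * 2)"
      using sums_mult[OF geometric_sums[of "1/2 :: real"]] by simp
    have sn: "summable (\<lambda>n. norm (p (y n)))"
      by (rule summable_comparison_test'[OF sums_summable[OF geo], of 0]) (simp add: pn)
    define a where "a = (\<Sum>n. p (y n))"
    have "(\<lambda>n. p (y n)) sums a"
      unfolding a_def by (rule summable_sums[OF summable_norm_cancel[OF sn]])
    then have lim_p: "(\<lambda>n. \<Sum>k<n. p (y k)) \<longlonglongrightarrow> a" by (simp add: sums_def)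
    \<comment> \<open>No norm bound on the \<open>W\<close>-parts is at hand; their partial sums
      converge by this identity.\<close>
    have tele: "(\<Sum>k<n. q (y k)) = (z + w) - y n - (\<Sum>k<n. p (y k))" for n
      by (induction n) (simp_all add: y0 yS)
    have "(\<lambda>n. norm (z + w) * (1/2)^n) \<longlonglongrightarrow> 0"
      by (intro tendsto_mult_right_zero LIMSEQ_realpow_zero) auto
    then have "y \<longlonglongrightarrow> 0"
      using yn by (intro Lim_null_comparison[of y]) auto
    then have lim_q: "(\<lambda>n. \<Sum>k<n. q (y k)) \<longlonglongrightarrow> (z + w) - 0 - a"
      unfolding tele by (intro tendsto_intros lim_p)
    have in_ZW: "(\<Sum>k<n. p (y k)) \<in> Z" "(\<Sum>k<n. q (y k)) \<in> W" for n
      using pq(1,2)[OF yY] sub by (auto intro: subspace_sum)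
    have "a \<in> Z" "(z + w) - 0 - a \<in> W"
      by (rule closed_sequentially[OF sub(3) in_ZW(1) lim_p],
          rule closed_sequentially[OF sub(4) in_ZW(2) lim_q])
    then have "z - a \<in> Z" "((z + w) - 0 - a) - w \<in> W"
      using zw sub(1,2) subspace_diff by blast+
    then have "z - a \<in> Z \<inter> W" by simp
    then have "z = a" using ZW by auto
    have "norm a \<le> (\<Sum>n. norm (p (y n)))" unfolding a_def by (rule summable_norm[OF sn])
    also have "\<dots> \<le> K * norm (z + w) * 2"
      using suminf_le[OF pn sn sums_summable[OF geo]] sums_unique[OF geo] by simp
    finally show ?thesis using \<open>z = a\<close> by (simp add: mult_ac)
  qed
  then show thesis by (rule that)
qed

section \<open>Coding sequences by points of the Baire space\<close>

text \<open>Dropping terms that are too large makes every index sequence admissible: the series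
  converges uniformly on the whole Baire space.\<close>

definition clipped :: "(nat \<Rightarrow> 'a::real_normed_vector) \<Rightarrow> nat \<Rightarrow> nat \<Rightarrow> 'a" where
  "clipped d n j = (if norm (d j) \<le> (1/2)^n then d j else 0)"

text \<open>The leading term is not clipped, so that points of arbitrarily large norm are
  reached.\<close>

definition coded_point :: "(nat \<Rightarrow> 'a::banach) \<Rightarrow> (nat \<Rightarrow> nat) \<Rightarrow> 'a" where
  "coded_point d \<tau> = d (\<tau> 0) + (\<Sum>n. clipped d n (\<tau> (Suc n)))"

lemma continuous_on_discrete_coordinate:
  fixes g :: "nat \<Rightarrow> 'a::topological_space"
  shows "continuous_on S (\<lambda>\<tau> :: nat \<Rightarrow> nat. g (\<tau> n))"
proof (rule continuous_on_compose2[of UNIV g])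
  show "continuous_on UNIV g" by simp
  show "continuous_on S (\<lambda>\<tau> :: nat \<Rightarrow> nat. \<tau> n)"
    by (rule continuous_on_subset[OF continuous_on_product_coordinates]) simp
qed simp

lemma continuous_on_coded_point: "continuous_on UNIV (coded_point d)"
proof -
  have "uniform_limit UNIV (\<lambda>N \<tau>. \<Sum>n<N. clipped d n (\<tau> (Suc n)))
      (\<lambda>\<tau>. \<Sum>n. clipped d n (\<tau> (Suc n))) sequentially"
    by (rule Weierstrass_m_test[where M = "\<lambda>n. (1/2)^n"])
      (auto simp: clipped_def summable_geometric)
  then have "continuous_on UNIV (\<lambda>\<tau>. \<Sum>n. clipped d n (\<tau> (Suc n)))"
    by (rule uniform_limit_theorem[rotated])
      (auto intro!: always_eventually continuous_on_sum continuous_on_discrete_coordinate)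
  then show ?thesis
    unfolding coded_point_def by (intro continuous_on_add continuous_on_discrete_coordinate)
qed

text \<open>Greedy expansion: the current error is approximated by a term of \<open>d\<close>, which
  is then subtracted.\<close>

lemma surj_coded_point:
  assumes dense: "closure (range d) = UNIV"
  shows "surj (coded_point d)"
proof -
  have "\<exists>\<tau>. coded_point d \<tau> = x" for x
  proof -
    have "\<exists>j. norm (u - d j) \<le> e" if "e > 0" for u e
    proof -
      have "u \<in> closure (range d)" using dense by simp
      then obtain y where "y \<in> range d" "dist y u < e"
        using \<open>e > 0\<close> unfolding closure_approachable by blast
      then show ?thesis by (auto simp: dist_norm norm_minus_commute intro: less_imp_le)
    qed
    then have "\<exists>j. norm (u - d j) \<le> (1/2)^n" for u n by simp
    then obtain j where j: "\<And>u n. norm (u - d (j u n)) \<le> (1/2)^n" by metis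
    \<comment> \<open>The accuracy index \<open>n+2\<close> ensures that clipping never acts: the
      error before stage \<open>n\<close> is at most \<open>(1/2)^(n+1)\<close>, so the chosen term
      has norm at most \<open>(1/2)^(n+1) + (1/2)^(n+2)\<close>, which is below
      \<open>(1/2)^n\<close>.\<close>
    define e where "e = rec_nat (x - d (j x 1)) (\<lambda>n u. u - d (j u (n+2)))"
    define \<tau> where "\<tau> n = (case n of 0 \<Rightarrow> j x 1 | Suc n \<Rightarrow> j (e n) (n+2))" for n
    have e0: "e 0 = x - d (j x 1)" and eS: "e (Suc n) = e n - d (j (e n) (n+2))" for n
      by (simp_all add: e_def)
    have en: "norm (e n) \<le> (1/2)^(n+1)" for n
    proof (cases n)
      case 0
      then show ?thesis using j[of x 1] by (simp add: e0)
    next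
      case (Suc m)
      then show ?thesis using j[of "e m" "m+2"] by (simp add: eS)
    qed
    have "norm (d (j (e n) (n+2))) \<le> (1/2)^n" for n
    proof -
      have "norm (d (j (e n) (n+2))) \<le> norm (e n) + norm (e n - d (j (e n) (n+2)))"
        using norm_triangle_sub[of "d (j (e n) (n+2))" "e n"] by (simp add: norm_minus_commute)
      also have "\<dots> \<le> (1/2)^(n+1) + (1/2)^(n+2)" by (intro add_mono en j)
      also have "\<dots> \<le> (1/2)^n" by simp
      finally show ?thesis .
    qed
    then have clip: "clipped d n (\<tau> (Suc n)) = d (j (e n) (n+2))" for n
      by (simp add: clipped_def \<tau>_def)
    have tele: "(\<Sum>k<n. clipped d k (\<tau> (Suc k))) = e 0 - e n" for n
      by (induction n) (simp_all add: clip eS)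
    have "(\<lambda>n. (1/2)^(n+1) :: real) \<longlonglongrightarrow> 0"
      by (rule LIMSEQ_ignore_initial_segment[OF LIMSEQ_realpow_zero]) auto
    then have "e \<longlonglongrightarrow> 0"
      by (rule Lim_null_comparison[rotated]) (rule always_eventually, rule allI, rule en)
    then have "(\<lambda>n. e 0 - e n) \<longlonglongrightarrow> e 0 - 0" by (intro tendsto_intros)
    then have "(\<lambda>n. clipped d n (\<tau> (Suc n))) sums e 0" by (simp add: sums_def tele)
    then have "coded_point d \<tau> = d (j x 1) + e 0"
      by (simp add: coded_point_def sums_iff) (simp add: \<tau>_def)
    then show ?thesis by (auto simp: e0)
  qed
  then show ?thesis unfolding surj_def by metis
qed

text \<open>\<open>prod_encode\<close> splits one point of the Baire space into countably many
  independent ones, each coding one term.\<close>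

lemma continuous_surjection_Baire_to_sequences:
  fixes d :: "nat \<Rightarrow> 'a::banach"
  assumes "closure (range d) = UNIV"
  obtains X :: "(nat \<Rightarrow> nat) \<Rightarrow> nat \<Rightarrow> 'a"
  where "\<And>k. continuous_on UNIV (\<lambda>\<sigma>. X \<sigma> k)" "surj X"
proof
  let ?X = "\<lambda>\<sigma> k. coded_point d (\<lambda>n. \<sigma> (prod_encode (k, n)))"
  show "continuous_on UNIV (\<lambda>\<sigma>. ?X \<sigma> k)" for k
    by (rule continuous_on_compose2[OF continuous_on_coded_point])
      (auto intro!: continuous_on_coordinatewise_then_product)
  have "\<exists>\<sigma>. ?X \<sigma> = x" for x
  proof -
    have "\<exists>\<tau>. coded_point d \<tau> = x k" for k
      using surj_coded_point[OF assms] unfolding surj_def by metis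
    then obtain \<tau> where "\<And>k. coded_point d (\<tau> k) = x k" by metis
    then show ?thesis
      by (intro exI[of _ "\<lambda>m. \<tau> (fst (prod_decode m)) (snd (prod_decode m))"]) simp
  qed
  then show "surj ?X" unfolding surj_def by metis
qed

section \<open>Spans of sequences as finite linear combinations\<close>

lemma span_image_lessThan:
  fixes x :: "nat \<Rightarrow> 'a::real_vector"
  shows "span (x ` {..<k}) = range (\<lambda>a. \<Sum>i<k. a i *\<^sub>R x i)"
proof (induction k)
  case (Suc k)
  show ?case
  proof safe
    fix v assume "v \<in> span (x ` {..<Suc k})"
    then obtain c where "v - c *\<^sub>R x k \<in> span (x ` {..<k})"
      by (auto simp: lessThan_Suc span_insert)
    then obtain a where "v - c *\<^sub>R x k = (\<Sum>i<k. a i *\<^sub>R x i)" using Suc by auto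
    then have "v = (\<Sum>i<Suc k. (a(k := c)) i *\<^sub>R x i)" by (simp add: algebra_simps)
    then show "v \<in> range (\<lambda>a. \<Sum>i<Suc k. a i *\<^sub>R x i)" by blast
  next
    fix a
    show "(\<Sum>i<Suc k. a i *\<^sub>R x i) \<in> span (x ` {..<Suc k})"
      by (rule span_sum, rule span_scale, rule span_base) auto
  qed
qed simp

lemma span_range_nat:
  fixes x :: "nat \<Rightarrow> 'a::real_vector"
  shows "span (range x) = (\<Union>k. span (x ` {..<k}))"
proof safe
  fix v assume "v \<in> span (range x)"
  then obtain t r where t: "finite t" "t \<subseteq> range x" "v = (\<Sum>a\<in>t. r a *\<^sub>R a)"
    unfolding span_explicit by blast
  obtain I where I: "finite I" "t = x ` I" using finite_subset_image[OF t(1,2)] by blast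
  obtain k where "I \<subseteq> {..<k}" using I(1) finite_nat_iff_bounded by blast
  then have "t \<subseteq> x ` {..<k}" using I(2) by blast
  then have "v \<in> span (x ` {..<k})" unfolding t(3)
    by (intro span_sum span_scale) (auto intro: span_base)
  then show "v \<in> (\<Union>k. span (x ` {..<k}))" by blast
next
  fix v k assume "v \<in> span (x ` {..<k})"
  then show "v \<in> span (range x)" using span_mono[of "x ` {..<k}" "range x"] by blast
qed

text \<open>Here \<open>k\<close> and \<open>a\<close> range over sets independent of
  \<open>x\<close>, so conditions on the span become intersections or unions of conditions
  continuous in the terms of \<open>x\<close>.\<close>

lemma mem_span_range_nat_iff:
  fixes x :: "nat \<Rightarrow> 'a::real_vector"
  shows "v \<in> span (range x) \<longleftrightarrow> (\<exists>k a. v = (\<Sum>i<k. a i *\<^sub>R x i))"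
  unfolding span_range_nat span_image_lessThan by (simp add: image_iff)

section \<open>Sequences spanning spaces that are not hereditarily indecomposable\<close>

text \<open>Zero padding lets a finite spanning list count as a sequence, and the condition is
  visibly a countable union of closed ones.\<close>

definition eventually_zero :: "(nat \<Rightarrow> 'a::zero) \<Rightarrow> bool" where
  "eventually_zero x \<longleftrightarrow> (\<exists>m. \<forall>k\<ge>m. x k = 0)"

text \<open>The terms \<open>x (3*k+2)\<close> are unconstrained: they allow the closed span to be larger than
  the closed sum of the two subspaces.\<close>

definition splitting :: "nat \<Rightarrow> (nat \<Rightarrow> 'a::real_normed_vector) \<Rightarrow> bool" where
  "splitting C x \<longleftrightarrow> separated (\<lambda>k. x (3*k)) \<and> separated (\<lambda>k. x (3*k+1)) \<and>
     (\<forall>u\<in>span (range (\<lambda>k. x (3*k))). \<forall>v\<in>span (range (\<lambda>k. x (3*k+1))).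
        norm u \<le> real C * norm (u + v))"

lemma subspace_closure:
  fixes S :: "'a::real_normed_vector set"
  assumes "subspace S"
  shows "subspace (closure S)"
proof (rule subspaceI)
  show "0 \<in> closure S" using subspace_0[OF assms] closure_subset by blast
next
  fix u v assume "u \<in> closure S" "v \<in> closure S"
  then obtain a b where "\<And>n. a n \<in> S" "a \<longlonglongrightarrow> u" "\<And>n. b n \<in> S" "b \<longlonglongrightarrow> v"
    unfolding closure_sequential by blast
  then have "\<forall>n. a n + b n \<in> S" "(\<lambda>n. a n + b n) \<longlonglongrightarrow> u + v"
    using assms by (auto intro: subspace_add tendsto_add)
  then show "u + v \<in> closure S"
    unfolding closure_sequential by (intro exI[of _ "\<lambda>n. a n + b n"] conjI)
next
  fix c :: real and u assume "u \<in> closure S"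
  then obtain a where "\<And>n. a n \<in> S" "a \<longlonglongrightarrow> u"
    unfolding closure_sequential by blast
  then have "\<forall>n. c *\<^sub>R a n \<in> S" "(\<lambda>n. c *\<^sub>R a n) \<longlonglongrightarrow> c *\<^sub>R u"
    using assms by (auto intro: subspace_scale tendsto_intros)
  then show "c *\<^sub>R u \<in> closure S"
    unfolding closure_sequential by (intro exI[of _ "\<lambda>n. c *\<^sub>R a n"] conjI)
qed

lemma closed_subspace_closure_span: "closed_subspace (closure (span S))"
  by (simp add: closed_subspace_def subspace_closure)

section \<open>From sequences to subspaces that are not hereditarily indecomposable\<close>

lemma not_HI_eventually_zero:
  assumes "eventually_zero x"
  shows "\<not> hereditarily_indecomposable (closure (span (range x)))"
proof -
  obtain m where m: "\<And>k. k \<ge> m \<Longrightarrow> x k = 0" using assms by (auto simp: eventually_zero_def)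
  have "x k \<in> span (x ` {..<m})" for k
    using m[of k] by (cases "k < m") (auto intro: span_base span_zero)
  then have "span (range x) \<subseteq> span (x ` {..<m})"
    by (intro span_minimal subspace_span) blast
  then have "closure (span (range x)) \<subseteq> span (x ` {..<m})"
    by (intro closure_minimal closed_span_finite) auto
  then have "\<not> infinite_dimensional (closure (span (range x)))"
    unfolding infinite_dimensional_def by blast
  then show ?thesis by (simp add: hereditarily_indecomposable_def)
qed

text \<open>The inequality passes to the closures \<open>Z\<close> and \<open>W\<close> of the two
  spans. There it makes the sum closed, and for a common element \<open>z\<close>, applied to
  \<open>z\<close> and \<open>- z\<close>, it gives \<open>z = 0\<close>.\<close>

lemma not_HI_splitting:
  fixes x :: "nat \<Rightarrow> 'a::banach"
  assumes "splitting C x"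
  shows "\<not> hereditarily_indecomposable (closure (span (range x)))"
proof -
  let ?SZ = "span (range (\<lambda>k. x (3*k)))" and ?SW = "span (range (\<lambda>k. x (3*k+1)))"
  define Z where "Z = closure ?SZ"
  define W where "W = closure ?SW"
  have cs: "closed_subspace Z" "closed_subspace W"
    unfolding Z_def W_def by (rule closed_subspace_closure_span)+
  have sub: "subspace Z" "subspace W" using cs by (auto simp: closed_subspace_def)
  have bound: "norm z \<le> real C * norm (z + w)" if "z \<in> Z" "w \<in> W" for z w
  proof -
    obtain a where a: "\<And>n. a n \<in> ?SZ" "a \<longlonglongrightarrow> z"
      using \<open>z \<in> Z\<close> unfolding Z_def closure_sequential by blast
    obtain b where b: "\<And>n. b n \<in> ?SW" "b \<longlonglongrightarrow> w"
      using \<open>w \<in> W\<close> unfolding W_def closure_sequential by blast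
    have "(\<lambda>n. norm (a n)) \<longlonglongrightarrow> norm z"
      using a(2) by (rule tendsto_norm)
    moreover have "(\<lambda>n. real C * norm (a n + b n)) \<longlonglongrightarrow> real C * norm (z + w)"
      using a(2) b(2) by (intro tendsto_intros)
    moreover have "norm (a n) \<le> real C * norm (a n + b n)" for n
      using assms a(1)[of n] b(1)[of n] unfolding splitting_def by blast
    ultimately show ?thesis by (intro LIMSEQ_le) blast+
  qed
  define Y where "Y = {z + w | z w. z \<in> Z \<and> w \<in> W}"
  have "closed_subspace Y"
    unfolding closed_subspace_def Y_def
    using subspace_sums[OF sub] closed_sum_if_bounded_projection[OF cs bound] by blast
  moreover have "Y \<subseteq> closure (span (range x))"
  proof -
    have "Z \<subseteq> closure (span (range x))" "W \<subseteq> closure (span (range x))"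
      unfolding Z_def W_def by (intro closure_mono span_mono; auto)+
    then show ?thesis
      using closed_subspace_closure_span[of "range x"]
      unfolding Y_def closed_subspace_def by (auto intro: subspace_add)
  qed
  moreover have "decomposable Y"
  proof -
    have "x (3*k) \<in> Z" "x (3*k+1) \<in> W" for k
      unfolding Z_def W_def
      by (rule subsetD[OF closure_subset], rule span_base, blast)+
    then have "infinite_dimensional Z" "infinite_dimensional W"
      using assms separated_infinite_dimensional[of "\<lambda>k. x (3*k)" Z]
        separated_infinite_dimensional[of "\<lambda>k. x (3*k+1)" W] unfolding splitting_def by blast+
    moreover have "Z \<inter> W = {0}"
    proof -
      have "z = 0" if "z \<in> Z" "z \<in> W" for z
        using bound[of z "- z"] that sub by (simp add: subspace_neg)
      then show ?thesis using sub subspace_0 by blast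
    qed
    ultimately show ?thesis unfolding decomposable_def Y_def using cs by blast
  qed
  ultimately show ?thesis unfolding hereditarily_indecomposable_def by blast
qed

section \<open>From subspaces that are not hereditarily indecomposable to sequences\<close>

lemma dense_sequence_subset:
  fixes d :: "nat \<Rightarrow> 'a::metric_space"
  assumes "closure (range d) = UNIV" "S \<noteq> {}"
  obtains s :: "nat \<Rightarrow> 'a" where "range s \<subseteq> S" "S \<subseteq> closure (range s)"
proof -
  obtain a where "a \<in> S" using assms(2) by blast
  \<comment> \<open>The points of \<open>d\<close> need not lie in \<open>S\<close>. Each ball of
    radius \<open>1 / Suc n\<close> about one of them that meets \<open>S\<close> contributes a
    point of \<open>S\<close> inside it; for the other balls \<open>a\<close> will do.\<close>
  then have "\<exists>y\<in>S. (\<exists>p\<in>S. dist p (d j) < 1 / Suc n) \<longrightarrow> dist y (d j) < 1 / Suc n" for j n :: nat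
    by blast
  then obtain g where g: "\<And>j n. g j n \<in> S"
    "\<And>j n p. p \<in> S \<Longrightarrow> dist p (d j) < 1 / Suc n \<Longrightarrow> dist (g j n) (d j) < 1 / Suc n"
    by metis
  show thesis
  proof
    let ?s = "\<lambda>k. case_prod g (prod_decode k)"
    show "range ?s \<subseteq> S" using g(1) by (auto split: prod.split)
    show "S \<subseteq> closure (range ?s)"
    proof
      fix p assume p: "p \<in> S"
      show "p \<in> closure (range ?s)"
        unfolding closure_approachable
      proof (intro allI impI)
        fix e :: real assume "e > 0"
        then obtain n where n: "1 / Suc n < e / 2" using nat_approx_posE[of "e/2"] by auto
        have "p \<in> closure (range d)" using assms(1) by simp
        then have "\<exists>y\<in>range d. dist y p < 1 / Suc n"
          unfolding closure_approachable by simp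
        then obtain j where j: "dist p (d j) < 1 / Suc n" by (auto simp: dist_commute)
        have "dist (g j n) p < e"
          using dist_triangle2[of "g j n" p "d j"] g(2)[OF p j] j n by simp
        moreover have "g j n = ?s (prod_encode (j, n))" by simp
        ultimately show "\<exists>y\<in>range ?s. dist y p < e" by (metis rangeI)
      qed
    qed
  qed
qed

text \<open>A maximal independent subset is finite here; it is listed and followed by zeros.\<close>

lemma finite_dimensional_eventually_zero:
  fixes X :: "'a::real_normed_vector set"
  assumes "subspace X" "\<not> infinite_dimensional X"
  obtains x where "eventually_zero x" "closure (span (range x)) = X"
proof -
  obtain F where F: "finite F" "X \<subseteq> span F"
    using assms(2) by (auto simp: infinite_dimensional_def)
  obtain B where B: "B \<subseteq> X" "independent B" "X \<subseteq> span B"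
    by (rule maximal_independent_subset[of X])
  have "finite B" using independent_span_bound[OF F(1) B(2)] B(1) F(2) by blast
  then obtain l where l: "set l = B" using finite_list by blast
  define x where "x k = (if k < length l then l ! k else 0)" for k
  have "range x \<subseteq> X"
    using B(1) l subspace_0[OF assms(1)] by (auto simp: x_def)
  then have "span (range x) \<subseteq> X" by (intro span_minimal assms(1))
  moreover have "B \<subseteq> range x"
  proof
    fix b assume "b \<in> B"
    then obtain k where "k < length l" "b = l ! k" using l by (metis in_set_conv_nth)
    then have "b = x k" by (simp add: x_def)
    then show "b \<in> range x" by blast
  qed
  then have "X \<subseteq> span (range x)" using B(3) span_mono by blast
  ultimately have eq: "span (range x) = X" by blast
  have "closed X"
    using closed_span_finite[OF \<open>finite B\<close>] B(1,3) span_minimal[OF B(1) assms(1)] by (metis subset_antisym)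
  then have "closure (span (range x)) = X" using eq by simp
  moreover have "eventually_zero x" 
    unfolding eventually_zero_def by (rule exI[of _ "length l"]) (simp add: x_def)
  ultimately show thesis using that by blast
qed

lemma decomposable_splitting:
  fixes d :: "nat \<Rightarrow> 'a::banach"
    and X Y :: "'a set"
  assumes dense: "closure (range d) = UNIV" and X: "closed_subspace X"
    and Y: "closed_subspace Y" "Y \<subseteq> X" "decomposable Y"
  obtains C x where "splitting C x" "closure (span (range x)) = X"
proof -
  obtain Z W where Z: "closed_subspace Z" "infinite_dimensional Z"
    and W: "closed_subspace W" "infinite_dimensional W"
    and ZW: "Z \<inter> W = {0}" "{z + w | z w. z \<in> Z \<and> w \<in> W} = Y"
    using Y(3) unfolding decomposable_def by blast
  have sub: "subspace Z" "subspace W" "subspace X" "closed X"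
    using X Z(1) W(1) by (auto simp: closed_subspace_def)
  obtain z where z: "separated z" "range z \<subseteq> Z"
    using infinite_dimensional_separated[OF sub(1) Z(2)] by blast
  obtain w where w: "separated w" "range w \<subseteq> W"
    using infinite_dimensional_separated[OF sub(2) W(2)] by blast
  have "X \<noteq> {}" using subspace_0[OF sub(3)] by blast
  then obtain s :: "nat \<Rightarrow> 'a" where s: "range s \<subseteq> X" "X \<subseteq> closure (range s)"
    by (rule dense_sequence_subset[OF dense])
  have "closed {z + w | z w. z \<in> Z \<and> w \<in> W}"
    unfolding ZW(2) using Y(1) by (simp add: closed_subspace_def)
  then obtain C where C: "\<And>u v. u \<in> Z \<Longrightarrow> v \<in> W \<Longrightarrow> norm u \<le> C * norm (u + v)"
    by (rule direct_sum_bounded_projection[OF Z(1) W(1) ZW(1)]) (rule that)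
  \<comment> \<open>Natural constants keep the later union over all constants countable.\<close>
  obtain N where N: "C \<le> real N" using real_arch_simple by blast
  \<comment> \<open>Interleaves the witnesses for \<open>Z\<close> and \<open>W\<close> with a
    sequence dense in \<open>X\<close>; the latter makes the closed span all of
    \<open>X\<close>.\<close>
  define x where "x k = (if k mod 3 = 0 then z (k div 3) else if k mod 3 = 1 then w (k div 3)
      else s (k div 3))" for k
  have xz: "x (3*k) = z k" for k by (simp add: x_def)
  have xw: "x (3*k+1) = w k" for k
  proof -
    have "(3*k+1) mod 3 = 1" "(3*k+1) div 3 = k" by presburger+
    then show ?thesis unfolding x_def by simp
  qed
  have xs: "x (3*k+2) = s k" for k
  proof -
    have "(3*k+2) mod 3 = 2" "(3*k+2) div 3 = k" by presburger+
    then show ?thesis unfolding x_def by simp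
  qed
  have "norm u \<le> real N * norm (u + v)" if "u \<in> span (range z)" "v \<in> span (range w)" for u v
  proof -
    have "u \<in> Z" "v \<in> W"
      using that span_minimal[OF z(2) sub(1)] span_minimal[OF w(2) sub(2)] by blast+
    then have "norm u \<le> C * norm (u + v)" by (rule C)
    also have "\<dots> \<le> real N * norm (u + v)" using N by (intro mult_right_mono) auto
    finally show ?thesis .
  qed
  then have "splitting N x" unfolding splitting_def xz xw using z(1) w(1) by blast
  moreover have "closure (span (range x)) = X"
  proof
    have "Z \<subseteq> X" "W \<subseteq> X"
    proof -
      have "u + v \<in> X" if "u \<in> Z" "v \<in> W" for u v
        using that ZW(2) Y(2) by blast
      from this[OF _ subspace_0[OF sub(2)]] this[OF subspace_0[OF sub(1)]]
      show "Z \<subseteq> X" "W \<subseteq> X" by auto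
    qed
    then have "z k \<in> X" "w k \<in> X" "s k \<in> X" for k using z(2) w(2) s(1) by blast+
    then have "range x \<subseteq> X" unfolding x_def by auto
    then show "closure (span (range x)) \<subseteq> X"
      by (intro closure_minimal span_minimal sub)
    have "range s \<subseteq> range x" using xs by (metis image_subsetI rangeI)
    then have "closure (range s) \<subseteq> closure (span (range x))"
      by (intro closure_mono) (meson order_trans span_superset)
    then show "X \<subseteq> closure (span (range x))" using s(2) by blast
  qed
  ultimately show thesis using that by blast
qed

section \<open>Measurability\<close>

text \<open>The intersection runs over uncountably many coefficient functions, which is harmless
  because each weak inequality defines a closed set.\<close>

lemma closed_Collect_separated:
  fixes X :: "'b::topological_space \<Rightarrow> nat \<Rightarrow> 'a::real_normed_vector"
  assumes "\<And>k. continuous_on UNIV (\<lambda>\<sigma>. X \<sigma> k)"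
  shows "closed {\<sigma>. separated (X \<sigma>)}"
proof -
  have "{\<sigma>. separated (X \<sigma>)} = (\<Inter>k. \<Inter>a. {\<sigma>. 1 \<le> norm (X \<sigma> k - (\<Sum>i<k. a i *\<^sub>R X \<sigma> i))})"
    unfolding separated_def span_image_lessThan by auto
  also have "closed \<dots>"
    by (intro closed_INT ballI closed_Collect_le continuous_intros assms)
  finally show ?thesis .
qed

lemma closed_Collect_splitting:
  fixes X :: "'b::topological_space \<Rightarrow> nat \<Rightarrow> 'a::real_normed_vector"
  assumes "\<And>k. continuous_on UNIV (\<lambda>\<sigma>. X \<sigma> k)"
  shows "closed {\<sigma>. splitting C (X \<sigma>)}"
proof -
  let ?u = "\<lambda>\<sigma> k a. \<Sum>i<k. a i *\<^sub>R X \<sigma> (3*i)" and ?v = "\<lambda>\<sigma> l b. \<Sum>i<l. b i *\<^sub>R X \<sigma> (3*i+1)"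
  have "{\<sigma>. splitting C (X \<sigma>)} =
      {\<sigma>. separated (\<lambda>k. X \<sigma> (3*k))} \<inter> {\<sigma>. separated (\<lambda>k. X \<sigma> (3*k+1))} \<inter>
      (\<Inter>k::nat. \<Inter>a. \<Inter>l::nat. \<Inter>b. {\<sigma>. norm (?u \<sigma> k a) \<le> real C * norm (?u \<sigma> k a + ?v \<sigma> l b)})"
    unfolding splitting_def Ball_def mem_span_range_nat_iff by auto
  also have "closed \<dots>"
    by (intro closed_Int closed_INT ballI closed_Collect_le closed_Collect_separated
        continuous_intros assms)
  finally show ?thesis .
qed

text \<open>An open set meets a closure only if it meets the set itself, so a single finite
  combination already lies in \<open>U\<close>. This handles the generators of the Effros
  structure.\<close>

lemma open_Collect_closure_span_meets:
  fixes X :: "'b::topological_space \<Rightarrow> nat \<Rightarrow> 'a::real_normed_vector"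
  assumes cont: "\<And>k. continuous_on UNIV (\<lambda>\<sigma>. X \<sigma> k)" and U: "open U"
  shows "open {\<sigma>. closure (span (range (X \<sigma>))) \<inter> U \<noteq> {}}"
proof -
  have "closure (span (range (X \<sigma>))) \<inter> U \<noteq> {} \<longleftrightarrow> (\<exists>k a. (\<Sum>i<k. a i *\<^sub>R X \<sigma> i) \<in> U)" for \<sigma>
  proof -
    have "closure (span (range (X \<sigma>))) \<inter> U \<noteq> {} \<longleftrightarrow> (\<exists>v. v \<in> span (range (X \<sigma>)) \<and> v \<in> U)"
      using open_Int_closure_eq_empty[OF U, of "span (range (X \<sigma>))"] by blast
    then show ?thesis unfolding mem_span_range_nat_iff by metis
  qed
  then have "{\<sigma>. closure (span (range (X \<sigma>))) \<inter> U \<noteq> {}} =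
      (\<Union>k. \<Union>a. (\<lambda>\<sigma>. \<Sum>i<k. a i *\<^sub>R X \<sigma> i) -` U)" by auto
  also have "open \<dots>"
    by (intro open_UN ballI open_vimage U continuous_intros cont)
  finally show ?thesis .
qed

lemma borel_Collect_eventually_zero_or_splitting:
  fixes X :: "'b::topological_space \<Rightarrow> nat \<Rightarrow> 'a::real_normed_vector"
  assumes "\<And>k. continuous_on UNIV (\<lambda>\<sigma>. X \<sigma> k)"
  shows "{\<sigma>. eventually_zero (X \<sigma>) \<or> (\<exists>C. splitting C (X \<sigma>))} \<in> sets borel"
proof -
  have "{\<sigma>. eventually_zero (X \<sigma>) \<or> (\<exists>C. splitting C (X \<sigma>))} =
      (\<Union>m. \<Inter>k\<in>{m..}. {\<sigma>. X \<sigma> k = 0}) \<union> (\<Union>C. {\<sigma>. splitting C (X \<sigma>)})"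
    unfolding eventually_zero_def by auto
  moreover have "closed (\<Inter>k\<in>{m..}. {\<sigma>. X \<sigma> k = 0})" for m
    by (intro closed_INT ballI closed_Collect_eq continuous_intros assms)
  moreover have "closed {\<sigma>. splitting C (X \<sigma>)}" for C
    by (rule closed_Collect_splitting[OF assms])
  ultimately show ?thesis by (auto intro!: sets.Un sets.countable_UN')
qed

section \<open>The complement as a Borel image of the Baire space\<close>

lemma closed_subspace_singleton_0: "closed_subspace {0}"
  by (simp add: closed_subspace_def subspace_single_0)

lemma space_SB_Effros: "space SB_Effros = SB"
  by (auto simp: SB_Effros_def intro!: space_measure_of)

theorem theorem5p10:
  shows "coanalytic_in SB_Effros {X \<in> SB. hereditarily_indecomposable X}"
proof -
  obtain d :: "nat \<Rightarrow> C_Delta" where d: "closure (range d) = UNIV"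
    using separable_C_Delta by blast
  obtain X :: "(nat \<Rightarrow> nat) \<Rightarrow> nat \<Rightarrow> C_Delta"
    where cont: "\<And>k. continuous_on UNIV (\<lambda>\<sigma>. X \<sigma> k)" and surj: "surj X"
    by (rule continuous_surjection_Baire_to_sequences[OF d]) (rule that)
  define G where "G = {\<sigma>. eventually_zero (X \<sigma>) \<or> (\<exists>C. splitting C (X \<sigma>))}"
  \<comment> \<open>The default \<open>{0}\<close> is finite dimensional, so it belongs to the
    complement and \<open>f\<close> is defined on the whole Baire space without enlarging the
    intended range.\<close>
  define f where "f \<sigma> = (if \<sigma> \<in> G then closure (span (range (X \<sigma>))) else {0})" for \<sigma>
  have f_SB: "f \<sigma> \<in> SB" for \<sigma>
    by (simp add: f_def SB_def closed_subspace_closure_span closed_subspace_singleton_0)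
  have "f \<in> measurable borel SB_Effros"
    unfolding SB_Effros_def
  proof (rule measurable_measure_of)
    fix A assume "A \<in> {{F \<in> SB. F \<inter> U \<noteq> {}} | U. open U}"
    then obtain U where U: "open U" "A = {F \<in> SB. F \<inter> U \<noteq> {}}" by blast
    \<comment> \<open>Off \<open>G\<close> the value \<open>{0}\<close> meets \<open>U\<close>
      exactly when \<open>0 \<in> U\<close>.\<close>
    have "f -` A \<inter> space borel =
        (G \<inter> {\<sigma>. closure (span (range (X \<sigma>))) \<inter> U \<noteq> {}}) \<union> (if 0 \<in> U then - G else {})"
      using f_SB by (auto simp: U(2) f_def)
    moreover have "G \<in> sets borel"
      unfolding G_def by (rule borel_Collect_eventually_zero_or_splitting[OF cont])
    moreover have "{\<sigma>. closure (span (range (X \<sigma>))) \<inter> U \<noteq> {}} \<in> sets borel"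
      using open_Collect_closure_span_meets[OF cont U(1)] by (rule borel_open)
    ultimately show "f -` A \<inter> space borel \<in> sets borel" by (auto intro: borel_comp)
  qed (use f_SB in auto)
  moreover have "range f = SB - {X \<in> SB. hereditarily_indecomposable X}"
  proof (intro equalityI subsetI)
    fix V assume "V \<in> range f"
    then obtain \<sigma> where \<sigma>: "V = f \<sigma>" by blast
    have "\<not> hereditarily_indecomposable {0 :: C_Delta}"
      unfolding hereditarily_indecomposable_def infinite_dimensional_def
      by (metis finite.emptyI order_refl span_empty)
    then have "\<not> hereditarily_indecomposable V"
      using not_HI_eventually_zero[of "X \<sigma>"] not_HI_splitting[of _ "X \<sigma>"]
      by (auto simp: \<sigma> f_def G_def)
    then show "V \<in> SB - {X \<in> SB. hereditarily_indecomposable X}"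
      using f_SB[of \<sigma>] by (simp add: \<sigma>)
  next
    fix V assume "V \<in> SB - {X \<in> SB. hereditarily_indecomposable X}"
    then have V: "V \<in> SB" "\<not> hereditarily_indecomposable V" by auto
    have cs: "closed_subspace V" using V(1) by (simp add: SB_def)
    have "\<exists>x. (eventually_zero x \<or> (\<exists>C. splitting C x)) \<and> closure (span (range x)) = V"
    proof (cases "infinite_dimensional V")
      case True
      then obtain Y where "closed_subspace Y" "Y \<subseteq> V" "decomposable Y"
        using V(2) unfolding hereditarily_indecomposable_def by blast
      then show ?thesis using decomposable_splitting[OF d cs] by metis
    next
      case False
      moreover have "subspace V" using cs by (simp add: closed_subspace_def)
      ultimately show ?thesis using finite_dimensional_eventually_zero by metis
    qed
    then obtain x where x: "eventually_zero x \<or> (\<exists>C. splitting C x)" "closure (span (range x)) = V"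
      by blast
    obtain \<sigma> where "x = X \<sigma>" using surj by (rule surjE)
    then have "f \<sigma> = V" using x by (simp add: f_def G_def)
    then show "V \<in> range f" by blast
  qed
  ultimately show ?thesis
    unfolding coanalytic_in_def analytic_in_def space_SB_Effros by blast
qed

end
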